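(* Let $\mathcal{S}$ be a separable metric space, $\mu$ a Borel probability measure on $\mathcal{S}$, and $\kappa:\mathcal{S}\times\mathcal{S}\to[0,1]$ a measurable symmetric kernel that is irreducible, continuous $(\mu\otimes\mu)$-almost everywhere, and satisfies $\lambda_*>0$. Suppose $\Delta_\ell<\infty$. Then \[ \Delta_u\le\Delta_\ell\le\Delta_u+2 . \] Moreover both bounds are tight: there exist such $(\mathcal{S},\mu,\kappa)$ with $\Delta_\ell<\infty$ and $\Delta_\ell=\Delta_u$, and there exist such $(\mathcal{S},\mu,\kappa)$ with $\Delta_\ell<\infty$ and $\Delta_\ell=\Delta_u+2$.
   Context: A kernel $\kappa$ on $(\mathcal{S},\mu)$ is reducible if there is a set $\mathcal{A}\subset\mathcal{S}$ with $0<\mu(\mathcal{A})<1$ such that $\kappa=0$ almost everywhere on $\mathcal{A}\times(\mathcal{S}\setminus\mathcal{A})$; otherwise it is irreducible. Put $\lambda(x)=\int_{\mathcal{S}}\kappa(x,y)\,d\mu(y)$ and $\lambda_*=\operatorname{ess\,inf}_x\lambda(x)$. For $\mathcal{A},\mathcal{B}\subset\mathcal{S}$ let $\kappa_\ell(\mathcal{A},\mathcal{B})=\operatorname{ess\,inf}\{\kappa(x,y):x\in\mathcal{A},y\in\mathcal{B}\}$ and $\kappa_u(\mathcal{A},\mathcal{B})=\operatorname{ess\,sup}\{\kappa(x,y):x\in\mathcal{A},y\in\mathcal{B}\}$. A partition always means a finite partition $\mathbb{A}=\{\mathcal{A}_1,\dots,\mathcal{A}_m\}$ of $\mathcal{S}$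 with no parts of $\mu$-measure zero. The lower partition graph $P_\ell(\mathbb{A})$ has vertex set $\mathbb{A}$, with $(\mathcal{A}_i,\mathcal{A}_j)$ an edge if $\kappa_\ell(\mathcal{A}_i,\mathcal{A}_j)>0$ (possibly $\mathcal{A}_i=\mathcal{A}_j$). The upper partition graph $P_u(\mathbb{A})$ has vertex set $\mathbb{A}$, with $(\mathcal{A}_i,\mathcal{A}_j)$ an edge if $\kappa_u(\mathcal{A}_i,\mathcal{A}_j)>0$. For vertices $u,v$ of a graph $G$ in the same connected component, $d_G(u,v)$ is the number of edges on a shortest path between them; $\operatorname{diam}G=\max_{u,v}d_G(u,v)$ for connected $G$, and $\operatorname{diam}G=\infty$ if $G$ is disconnected. Define $\Delta_\ell=\inf_{\mathbb{A}}\operatorname{diam}P_\ell(\mathbb{A})$ and $\Delta_u=\sup_{\mathbb{A}}\operatorname{diam}P_u(\mathbb{A})$, where $\mathbb{A}$ ranges over all partitions (with no measure zero sets).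
   Formalization: The distance from a part to itself counts only walks with at least one edge (1 with a loop, 2 with only other neighbours, infinite if isolated); with distance 0 the one-part partition gives Δ_ℓ=0 always, and κ=1 on [0,1] has Δ_u=1, so the claim would be false. *)

theory Defs
  imports "HOL-Probability.Probability"
begin

definition essinf :: "'a measure \<Rightarrow> ('a \<Rightarrow> ereal) \<Rightarrow> ereal" where
  "essinf M f = - esssup M (\<lambda>x. - f x)"

definition irreducible_kernel :: "'a measure \<Rightarrow> ('a \<times> 'a \<Rightarrow> real) \<Rightarrow> bool" where
  "irreducible_kernel M \<kappa> \<longleftrightarrow>
     \<not> (\<exists>A\<in>sets M. 0 < measure M A \<and> measure M A < 1 \<and>
          (AE z in M \<Otimes>\<^sub>M M. z \<in> A \<times> (space M - A) \<longrightarrow> \<kappa> z = 0))"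

definition kernel_degree :: "'a measure \<Rightarrow> ('a \<times> 'a \<Rightarrow> real) \<Rightarrow> 'a \<Rightarrow> real" where
  "kernel_degree M \<kappa> x = (\<integral>y. \<kappa> (x, y) \<partial>M)"

definition min_degree :: "'a measure \<Rightarrow> ('a \<times> 'a \<Rightarrow> real) \<Rightarrow> ereal" where
  "min_degree M \<kappa> = essinf M (\<lambda>x. ereal (kernel_degree M \<kappa> x))"

definition kernel_lower :: "'a measure \<Rightarrow> ('a \<times> 'a \<Rightarrow> real) \<Rightarrow> 'a set \<Rightarrow> 'a set \<Rightarrow> ereal" where
  "kernel_lower M \<kappa> A B = essinf (restrict_space (M \<Otimes>\<^sub>M M) (A \<times> B)) (\<lambda>z. ereal (\<kappa> z))"

definition kernel_upper :: "'a measure \<Rightarrow> ('a \<times> 'a \<Rightarrow> real) \<Rightarrow> 'a set \<Rightarrow> 'a set \<Rightarrow> ereal" where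
  "kernel_upper M \<kappa> A B = esssup (restrict_space (M \<Otimes>\<^sub>M M) (A \<times> B)) (\<lambda>z. ereal (\<kappa> z))"

definition positive_partition :: "'a measure \<Rightarrow> 'a set set \<Rightarrow> bool" where
  "positive_partition M P \<longleftrightarrow>
     finite P \<and> partition_on (space M) P \<and> (\<forall>A\<in>P. A \<in> sets M \<and> 0 < measure M A)"

text \<open>
  The partition graphs have vertex set \<open>P\<close> and are given by their edge relations, which
  may contain loops and are symmetric when \<open>\<kappa>\<close> is.
\<close>

definition lower_edges :: "'a measure \<Rightarrow> ('a \<times> 'a \<Rightarrow> real) \<Rightarrow> 'a set set \<Rightarrow> ('a set) rel" where
  "lower_edges M \<kappa> P = {(A, B). A \<in> P \<and> B \<in> P \<and> kernel_lower M \<kappa> A B > 0}"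

definition upper_edges :: "'a measure \<Rightarrow> ('a \<times> 'a \<Rightarrow> real) \<Rightarrow> 'a set set \<Rightarrow> ('a set) rel" where
  "upper_edges M \<kappa> P = {(A, B). A \<in> P \<and> B \<in> P \<and> kernel_upper M \<kappa> A B > 0}"

text \<open>
  For distinct vertices this is the usual length of a shortest path (\<open>\<infinity>\<close> if there is none).
  For \<open>u = v\<close> only walks with at least one edge count: the distance from a vertex to itself
  is 1 if it carries a loop, 2 if it only has other neighbours, and \<open>\<infinity>\<close> if it has no incident edge.
  A part of a partition stands for many points of the space, and this is the distance between
  two points of the same part. With value 0 instead, the one-part partition would make
  the infimum \<open>\<Delta>\<^sub>l\<close> below equal to 0 for every kernel.
\<close>

definition graph_dist :: "'v rel \<Rightarrow> 'v \<Rightarrow> 'v \<Rightarrow> enat" where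
  "graph_dist E u v = (INF n\<in>{n. 1 \<le> n \<and> (u, v) \<in> E ^^ n}. enat n)"

lemma graph_dist_distinct:
  assumes "u \<noteq> v"
  shows "graph_dist E u v = (INF n\<in>{n. (u, v) \<in> E ^^ n}. enat n)"
proof -
  have "{n. 1 \<le> n \<and> (u, v) \<in> E ^^ n} = {n. (u, v) \<in> E ^^ n}"
    using assms by (auto simp: Suc_le_eq intro: gr0I)
  then show ?thesis
    unfolding graph_dist_def by simp
qed

lemma graph_dist_self:
  assumes "sym E"
  shows "graph_dist E v v = (if (v, v) \<in> E then 1 else if \<exists>w. (v, w) \<in> E then 2 else \<infinity>)"
proof -
  consider "(v, v) \<in> E" | w where "(v, v) \<notin> E" "(v, w) \<in> E" | "\<nexists>w. (v, w) \<in> E"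
    by blast
  then show ?thesis
  proof cases
    case 1
    have "graph_dist E v v \<le> enat 1"
      unfolding graph_dist_def by (rule INF_lower) (use 1 in simp)
    moreover have "enat 1 \<le> graph_dist E v v"
      unfolding graph_dist_def by (rule INF_greatest) simp
    ultimately show ?thesis
      using 1 by (simp add: one_enat_def)
  next
    case 2
    have "(v, v) \<in> E ^^ 2"
      using 2 assms by (auto simp: numeral_2_eq_2 relcomp_unfold dest: symD)
    then have "graph_dist E v v \<le> enat 2"
      unfolding graph_dist_def by (intro INF_lower) simp
    moreover have "enat 2 \<le> graph_dist E v v"
      unfolding graph_dist_def
    proof (rule INF_greatest)
      fix n assume "n \<in> {n. 1 \<le> n \<and> (v, v) \<in> E ^^ n}"
      then have "1 \<le> n" "n \<noteq> 1"
        using 2 by auto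
      then show "enat 2 \<le> enat n"
        by simp
    qed
    ultimately show ?thesis
      using 2 by (auto simp: numeral_eq_enat)
  next
    case 3
    then have "(v, v) \<notin> E ^^ n" if "1 \<le> n" for n
      using that 3 by (cases n) (auto simp del: relpow.simps dest!: relpow_Suc_D2)
    then have "{n. 1 \<le> n \<and> (v, v) \<in> E ^^ n} = {}"
      by blast
    then have "graph_dist E v v = \<infinity>"
      unfolding graph_dist_def by (simp only: image_empty Inf_empty top_enat_def)
    then show ?thesis
      using 3 by auto
  qed
qed

definition graph_diam :: "'v set \<Rightarrow> 'v rel \<Rightarrow> enat" where
  "graph_diam V E = (SUP u\<in>V. SUP v\<in>V. graph_dist E u v)"

definition Delta_lower :: "'a measure \<Rightarrow> ('a \<times> 'a \<Rightarrow> real) \<Rightarrow> enat" ("\<Delta>\<^sub>l") where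
  "\<Delta>\<^sub>l M \<kappa> = (INF P\<in>{P. positive_partition M P}. graph_diam P (lower_edges M \<kappa> P))"

definition Delta_upper :: "'a measure \<Rightarrow> ('a \<times> 'a \<Rightarrow> real) \<Rightarrow> enat" ("\<Delta>\<^sub>u") where
  "\<Delta>\<^sub>u M \<kappa> = (SUP P\<in>{P. positive_partition M P}. graph_diam P (upper_edges M \<kappa> P))"

text \<open>
  The separable metric space is the whole type: for metric spaces, separability and second
  countability coincide. It also makes the product \<open>\<sigma>\<close>-algebra of \<open>M \<Otimes>\<^sub>M M\<close> the Borel one.
\<close>

definition admissible_kernel ::
  "'a::{metric_space, second_countable_topology} measure \<Rightarrow> ('a \<times> 'a \<Rightarrow> real) \<Rightarrow> bool" where
  "admissible_kernel M \<kappa> \<longleftrightarrow>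
     prob_space M \<and> sets M = sets borel \<and>
     \<kappa> \<in> borel_measurable (M \<Otimes>\<^sub>M M) \<and>
     (\<forall>z. 0 \<le> \<kappa> z \<and> \<kappa> z \<le> 1) \<and>
     (\<forall>x y. \<kappa> (x, y) = \<kappa> (y, x)) \<and>
     irreducible_kernel M \<kappa> \<and>
     (AE z in M \<Otimes>\<^sub>M M. isCont \<kappa> z) \<and>
     min_degree M \<kappa> > 0"

end

theory Submission
  imports Defs
begin

text \<open>
  A lower walk in one partition induces an upper walk of the same length in any other one, through
  parts that meet the parts of the lower walk in positive measure; hence \<open>\<Delta>\<^sub>u \<le> \<Delta>\<^sub>l\<close>.

  For \<open>\<Delta>\<^sub>l \<le> \<Delta>\<^sub>u + 2\<close>, almost everywhere continuity gives countably many open rectangles \<open>U \<times> V\<close>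
  that cover \<open>{\<kappa> > 0}\<close> up to a null set and on each of which \<open>\<kappa>\<close> is bounded below by a positive
  constant. Let the neighbourhood of \<open>B\<close> be the union of all \<open>V\<close> with \<open>\<mu>(B \<inter> U) > 0\<close>. An upper walk in
  a partition that decides the iterated neighbourhoods of \<open>B\<close> shows that some iterate of order
  at most \<open>\<Delta>\<^sub>u\<close> meets \<open>B'\<close>, and tracing rectangles backwards turns this into a chain
  \<open>W\<^sub>0 \<subseteq> B, \<dots>, W\<^sub>n \<subseteq> B'\<close> with \<open>\<kappa>\<^sub>l(W\<^sub>i, W\<^sub>i\<^sub>+\<^sub>1) > 0\<close>. Given a partition whose lower graph has no isolated
  vertices, refine it by such chains between neighbours of any two of its parts.
\<close>

section \<open>Null sets, partitions and essential bounds on rectangles\<close>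

locale nonneg_kernel = prob_space M
  for M :: "'a::{metric_space, second_countable_topology} measure" +
  fixes \<kappa> :: "'a \<times> 'a \<Rightarrow> real"
  assumes sets_eq_borel: "sets M = sets borel"
    and kernel_measurable [measurable]: "\<kappa> \<in> borel_measurable (M \<Otimes>\<^sub>M M)"
    and kernel_nonneg: "0 \<le> \<kappa> z"
begin

text \<open>Positive probability is expressed as membership outside \<open>null_sets M\<close>,
  because closure under countable unions and measurable subsets drives most arguments below.\<close>

lemma pos_iff_not_null: "A \<in> sets M \<Longrightarrow> 0 < prob A \<longleftrightarrow> A \<notin> null_sets M"
  by (simp add: null_sets_def emeasure_eq_measure zero_less_measure_iff)

lemma partition_sets: "positive_partition M P \<Longrightarrow> A \<in> P \<Longrightarrow> A \<in> sets M"
  and partition_not_null: "positive_partition M P \<Longrightarrow> A \<in> P \<Longrightarrow> A \<notin> null_sets M"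
  using pos_iff_not_null by (auto simp: positive_partition_def)

lemma not_null_mono: "B \<in> sets M \<Longrightarrow> A \<subseteq> B \<Longrightarrow> A \<notin> null_sets M \<Longrightarrow> A \<in> sets M \<Longrightarrow> B \<notin> null_sets M"
  using null_sets_subset by blast

lemma not_null_almost_subset:
  assumes "A \<in> sets M" "B \<in> sets M" "A \<notin> null_sets M" "A - B \<in> null_sets M"
  shows "A \<inter> B \<notin> null_sets M"
proof
  assume "A \<inter> B \<in> null_sets M"
  then have "(A \<inter> B) \<union> (A - B) \<in> null_sets M"
    using assms(4) by blast
  then show False
    using assms(3) by (simp add: Int_Diff_Un)
qed

text \<open>The finitely many parts cover \<open>W\<close>, so their traces on \<open>W\<close>
  cannot all be null. This is how parts of one partition are matched with parts of another.\<close>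

lemma part_meets:
  assumes "positive_partition M P" "W \<in> sets M" "W \<notin> null_sets M"
  shows "\<exists>A\<in>P. A \<inter> W \<notin> null_sets M"
proof (rule ccontr)
  assume "\<not> ?thesis"
  then have "(\<Union>A\<in>P. A \<inter> W) \<in> null_sets M"
    using assms(1) by (intro null_sets_UN') (auto simp: positive_partition_def countable_finite)
  moreover have "(\<Union>A\<in>P. A \<inter> W) = W"
    using assms(1) sets.sets_into_space[OF assms(2)]
    by (auto simp: positive_partition_def partition_on_def)
  ultimately show False
    using assms(3) by simp
qed

lemma rectangle_null_iff:
  assumes "A \<in> sets M" "B \<in> sets M"
  shows "A \<times> B \<in> null_sets (M \<Otimes>\<^sub>M M) \<longleftrightarrow> A \<in> null_sets M \<or> B \<in> null_sets M"
  using assms by (auto simp: null_sets_def emeasure_pair_measure_Times)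

lemma AE_restrict_rectangle:
  assumes "A \<in> sets M" "B \<in> sets M"
  shows "(AE z in restrict_space (M \<Otimes>\<^sub>M M) (A \<times> B). Q z) \<longleftrightarrow> (AE z in M \<Otimes>\<^sub>M M. z \<in> A \<times> B \<longrightarrow> Q z)"
  using assms by (intro AE_restrict_space_iff) auto

lemma kernel_lower_pos_iff:
  assumes "A \<in> sets M" "B \<in> sets M"
  shows "kernel_lower M \<kappa> A B > 0 \<longleftrightarrow> (\<exists>c>0. AE z in M \<Otimes>\<^sub>M M. z \<in> A \<times> B \<longrightarrow> c \<le> \<kappa> z)"
proof -
  let ?R = "restrict_space (M \<Otimes>\<^sub>M M) (A \<times> B)"
  have [measurable]: "\<kappa> \<in> borel_measurable ?R"
    by (rule measurable_restrict_space1) simp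
  show ?thesis
  proof
    assume "kernel_lower M \<kappa> A B > 0"
    \<comment> \<open>The lower value may be infinite, for instance on a null rectangle, so a real
      constant strictly below it is taken.\<close>
    then obtain c where c: "0 < ereal c" "ereal c < kernel_lower M \<kappa> A B"
      using ereal_dense2 by blast
    have "AE z in ?R. - ereal (\<kappa> z) \<le> - kernel_lower M \<kappa> A B"
      using esssup_AE[of "\<lambda>z. - ereal (\<kappa> z)" ?R]
      by (simp add: kernel_lower_def essinf_def)
    then have "AE z in ?R. c \<le> \<kappa> z"
    proof (eventually_elim)
      case (elim z)
      then have "kernel_lower M \<kappa> A B \<le> ereal (\<kappa> z)"
        using ereal_minus_le_minus by blast
      with c(2) have "ereal c \<le> ereal (\<kappa> z)"
        by (meson less_imp_le order_trans)
      then show ?case by simp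
    qed
    then show "\<exists>c>0. AE z in M \<Otimes>\<^sub>M M. z \<in> A \<times> B \<longrightarrow> c \<le> \<kappa> z"
      using c(1) by (auto simp: AE_restrict_rectangle[OF assms])
  next
    assume "\<exists>c>0. AE z in M \<Otimes>\<^sub>M M. z \<in> A \<times> B \<longrightarrow> c \<le> \<kappa> z"
    then obtain c where c: "c > 0" "AE z in ?R. c \<le> \<kappa> z"
      by (auto simp: AE_restrict_rectangle[OF assms])
    have "esssup ?R (\<lambda>z. - ereal (\<kappa> z)) \<le> - ereal c"
      using c(2) by (intro esssup_I) auto
    then have "ereal c \<le> kernel_lower M \<kappa> A B"
      unfolding kernel_lower_def essinf_def by (metis ereal_minus_le_minus ereal_uminus_uminus)
    then show "kernel_lower M \<kappa> A B > 0"
      using c(1) by (meson ereal_less(2) less_le_trans)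
  qed
qed

text \<open>Nonnegativity turns an essential supremum of at most 0 into vanishing almost
  everywhere.\<close>

lemma kernel_upper_pos_iff:
  assumes "A \<in> sets M" "B \<in> sets M"
  shows "kernel_upper M \<kappa> A B > 0 \<longleftrightarrow> \<not> (AE z in M \<Otimes>\<^sub>M M. z \<in> A \<times> B \<longrightarrow> \<kappa> z = 0)"
proof -
  let ?R = "restrict_space (M \<Otimes>\<^sub>M M) (A \<times> B)"
  have [measurable]: "\<kappa> \<in> borel_measurable ?R"
    by (rule measurable_restrict_space1) simp
  have "kernel_upper M \<kappa> A B \<le> 0 \<longleftrightarrow> (AE z in ?R. ereal (\<kappa> z) \<le> 0)"
  proof
    assume *: "kernel_upper M \<kappa> A B \<le> 0"
    show "AE z in ?R. ereal (\<kappa> z) \<le> 0"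
      using esssup_AE[of "\<lambda>z. ereal (\<kappa> z)" ?R]
    proof eventually_elim
      case (elim z)
      with * show ?case
        unfolding kernel_upper_def by (rule order_trans[rotated])
    qed
  next
    assume "AE z in ?R. ereal (\<kappa> z) \<le> 0"
    then show "kernel_upper M \<kappa> A B \<le> 0"
      unfolding kernel_upper_def by (intro esssup_I) auto
  qed
  also have "\<dots> \<longleftrightarrow> (AE z in M \<Otimes>\<^sub>M M. z \<in> A \<times> B \<longrightarrow> \<kappa> z = 0)"
    unfolding AE_restrict_rectangle[OF assms]
    by (simp add: zero_ereal_def order_antisym_conv kernel_nonneg)
  finally show ?thesis
    by (meson linorder_not_le)
qed

text \<open>The part of \<open>C \<times> D\<close> outside \<open>A \<times> B\<close> lies in two
  null strips, so the same constant still works. Hence containment up to null sets suffices for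
  transferring lower edges to a refinement.\<close>

lemma kernel_lower_pos_mono:
  assumes "kernel_lower M \<kappa> A B > 0" "A \<in> sets M" "B \<in> sets M" "C \<in> sets M" "D \<in> sets M"
    and "C - A \<in> null_sets M" "D - B \<in> null_sets M"
  shows "kernel_lower M \<kappa> C D > 0"
proof -
  obtain c where c: "c > 0" "AE z in M \<Otimes>\<^sub>M M. z \<in> A \<times> B \<longrightarrow> c \<le> \<kappa> z"
    using assms kernel_lower_pos_iff by auto
  have "(C - A) \<times> space M \<in> null_sets (M \<Otimes>\<^sub>M M)" "space M \<times> (D - B) \<in> null_sets (M \<Otimes>\<^sub>M M)"
    using assms by auto
  from this[THEN AE_not_in] c(2) have "AE z in M \<Otimes>\<^sub>M M. z \<in> C \<times> D \<longrightarrow> c \<le> \<kappa> z"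
    by eventually_elim (use assms(4,5)[THEN sets.sets_into_space] in auto)
  then show ?thesis
    using c(1) assms(4,5) kernel_lower_pos_iff by auto
qed

lemma positive_partition_space: "positive_partition M {space M}"
  using not_empty by (auto simp: positive_partition_def partition_on_def prob_space)

text \<open>A refinement up to null sets: splitting off a null piece would create a null part.\<close>

lemma exists_refining_partition:
  assumes "finite F" "F \<subseteq> sets M"
  shows "\<exists>P. positive_partition M P \<and> (\<forall>A\<in>P. \<forall>S\<in>F. A - S \<in> null_sets M \<or> A \<inter> S \<in> null_sets M)"
  using assms
proof (induction F)
  case empty
  show ?case
    using positive_partition_space by blast
next
  case (insert S F)
  then obtain P where P: "positive_partition M P"
    and F: "\<And>A T. A \<in> P \<Longrightarrow> T \<in> F \<Longrightarrow> A - T \<in> null_sets M \<or> A \<inter> T \<in> null_sets M"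
    by auto
  have S [measurable]: "S \<in> sets M"
    using insert.prems by simp
  define f where "f A = (if A \<inter> S \<notin> null_sets M \<and> A - S \<notin> null_sets M then {A \<inter> S, A - S} else {A})" for A
  have f: "C \<subseteq> A \<and> C \<in> sets M \<and> C \<notin> null_sets M" if "A \<in> P" "C \<in> f A" for A C
  proof (cases "A \<inter> S \<notin> null_sets M \<and> A - S \<notin> null_sets M")
    case True
    with that have "C = A \<inter> S \<or> C = A - S"
      by (simp add: f_def)
    then show ?thesis
      using True partition_sets[OF P that(1)] S by (elim disjE) auto
  next
    case False
    with that have "C = A"
      by (simp add: f_def)
    then show ?thesis
      using partition_sets[OF P that(1)] partition_not_null[OF P that(1)] by simp
  qed
  have union_f: "\<Union>(f A) = A" for A
    by (auto simp: f_def)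
  have disj: "disjnt C D" if "A \<in> P" "B \<in> P" "C \<in> f A" "D \<in> f B" "C \<noteq> D" for A B C D
  proof (cases "A = B")
    case True
    then show ?thesis
      using that by (auto simp: f_def disjnt_def split: if_splits)
  next
    case False
    then have "A \<inter> B = {}"
      using P that by (auto simp: positive_partition_def partition_on_def disjoint_def)
    moreover have "C \<subseteq> A" "D \<subseteq> B"
      using f that by auto
    ultimately show ?thesis
      by (auto simp: disjnt_def)
  qed
  have "positive_partition M (\<Union>A\<in>P. f A)"
    unfolding positive_partition_def
  proof (intro conjI ballI)
    show "finite (\<Union>A\<in>P. f A)"
      using P by (auto simp: positive_partition_def f_def)
    show "partition_on (space M) (\<Union>A\<in>P. f A)"
    proof (rule partition_onI)
      have "\<Union>(\<Union>A\<in>P. f A) = (\<Union>A\<in>P. \<Union>(f A))"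
        by blast
      also have "\<dots> = space M"
        using P by (simp add: union_f positive_partition_def partition_on_def)
      finally show "\<Union>(\<Union>A\<in>P. f A) = space M" .
      show "{} \<notin> (\<Union>A\<in>P. f A)"
        using f null_sets.empty_sets by blast
    qed (use disj in blast)
    show "C \<in> sets M" "0 < prob C" if "C \<in> (\<Union>A\<in>P. f A)" for C
      using f that pos_iff_not_null by blast+
  qed
  moreover have "C - T \<in> null_sets M \<or> C \<inter> T \<in> null_sets M"
    if C: "C \<in> (\<Union>A\<in>P. f A)" and T: "T \<in> insert S F" for C T
  proof -
    \<comment> \<open>For \<open>T = S\<close> the alternative is built into \<open>f\<close>; for
      an older \<open>T\<close> the piece \<open>C\<close> inherits it from the part
      \<open>A\<close> that contains it.\<close>
    obtain A where A: "A \<in> P" "C \<in> f A"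
      using C by blast
    then have C: "C \<subseteq> A" "C \<in> sets M"
      using f by auto
    show ?thesis
    proof (cases "T = S")
      case True
      have "(A \<inter> S) - S = {}" "(A - S) \<inter> S = {}"
        by auto
      then have "A \<inter> S - S \<in> null_sets M" "(A - S) \<inter> S \<in> null_sets M"
        by (metis null_sets.empty_sets)+
      then show ?thesis
        using A True by (auto simp: f_def split: if_splits)
    next
      case False
      then have "T \<in> F"
        using T by simp
      then have TM: "T \<in> sets M"
        using insert.prems by auto
      from F[OF A(1) \<open>T \<in> F\<close>] show ?thesis
      proof
        assume *: "A - T \<in> null_sets M"
        have "C - T \<in> null_sets M"
          by (rule null_sets_subset[OF *]) (use C TM in auto)
        then show ?thesis ..
      next
        assume *: "A \<inter> T \<in> null_sets M"
        have "C \<inter> T \<in> null_sets M"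
          by (rule null_sets_subset[OF *]) (use C TM in auto)
        then show ?thesis ..
      qed
    qed
  qed
  ultimately show ?case
    by blast
qed

section \<open>From lower walks to upper walks: the bound
  \<open>\<Delta>\<^sub>u \<le> \<Delta>\<^sub>l\<close>\<close>

text \<open>The product of \<open>A \<inter> A'\<close> and \<open>B \<inter> B'\<close> is not null
  and carries the lower bound of \<open>A' \<times> B'\<close>, so the kernel cannot vanish almost
  everywhere on \<open>A \<times> B\<close>.\<close>

lemma lower_edge_imp_upper_edge:
  assumes "(A', B') \<in> lower_edges M \<kappa> Q" "positive_partition M P" "positive_partition M Q"
    and "A \<in> P" "B \<in> P" "A \<inter> A' \<notin> null_sets M" "B \<inter> B' \<notin> null_sets M"
  shows "(A, B) \<in> upper_edges M \<kappa> P"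
proof -
  have s: "A \<in> sets M" "B \<in> sets M" "A' \<in> sets M" "B' \<in> sets M"
    using assms partition_sets by (auto simp: lower_edges_def)
  then obtain c where c: "c > 0" "AE z in M \<Otimes>\<^sub>M M. z \<in> A' \<times> B' \<longrightarrow> c \<le> \<kappa> z"
    using assms(1) kernel_lower_pos_iff by (auto simp: lower_edges_def)
  have "\<not> (AE z in M \<Otimes>\<^sub>M M. z \<in> A \<times> B \<longrightarrow> \<kappa> z = 0)"
  proof
    assume "AE z in M \<Otimes>\<^sub>M M. z \<in> A \<times> B \<longrightarrow> \<kappa> z = 0"
    with c(2) have "AE z in M \<Otimes>\<^sub>M M. z \<notin> (A \<inter> A') \<times> (B \<inter> B')"
      by eventually_elim (use c(1) in auto)
    then have "(A \<inter> A') \<times> (B \<inter> B') \<in> null_sets (M \<Otimes>\<^sub>M M)"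
      using s by (subst (asm) AE_iff_null_sets[symmetric]) auto
    then show False
      using s assms rectangle_null_iff[of "A \<inter> A'" "B \<inter> B'"] by auto
  qed
  then show ?thesis
    using s assms kernel_upper_pos_iff by (auto simp: upper_edges_def)
qed

text \<open>Each intermediate vertex is replaced by any part of \<open>P\<close> that meets it. The
  length is positive because an empty walk at \<open>A'\<close> would not force
  \<open>A = B\<close>: several parts of \<open>P\<close> may meet \<open>A'\<close>.\<close>

lemma lower_walk_imp_upper_walk:
  assumes PQ: "positive_partition M P" "positive_partition M Q"
  shows "(A', B') \<in> lower_edges M \<kappa> Q ^^ Suc n \<Longrightarrow> A \<in> P \<Longrightarrow> B \<in> P \<Longrightarrow>
    A \<inter> A' \<notin> null_sets M \<Longrightarrow> B \<inter> B' \<notin> null_sets M \<Longrightarrow> (A, B) \<in> upper_edges M \<kappa> P ^^ Suc n"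
proof (induction n arbitrary: B B')
  case 0
  then show ?case
    using lower_edge_imp_upper_edge[OF _ PQ] by simp
next
  case (Suc n)
  then obtain C' where C': "(A', C') \<in> lower_edges M \<kappa> Q ^^ Suc n" "(C', B') \<in> lower_edges M \<kappa> Q"
    by (metis relpow_Suc_E)
  then have "C' \<in> Q"
    by (simp add: lower_edges_def)
  then obtain C where C: "C \<in> P" "C \<inter> C' \<notin> null_sets M"
    using part_meets[OF PQ(1)] partition_sets[OF PQ(2)] partition_not_null[OF PQ(2)] by blast
  then have "(A, C) \<in> upper_edges M \<kappa> P ^^ Suc n" "(C, B) \<in> upper_edges M \<kappa> P"
    using Suc C' lower_edge_imp_upper_edge[OF C'(2) PQ] by auto
  then show ?case
    by (metis relpow_Suc_I)
qed

lemma Delta_upper_le_Delta_lower: "\<Delta>\<^sub>u M \<kappa> \<le> \<Delta>\<^sub>l M \<kappa>"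
proof -
  have "graph_dist (upper_edges M \<kappa> P) A B \<le> graph_diam Q (lower_edges M \<kappa> Q)"
    if PQ: "positive_partition M P" "positive_partition M Q" and AB: "A \<in> P" "B \<in> P" for P Q A B
  proof -
    obtain A' where A': "A' \<in> Q" "A' \<inter> A \<notin> null_sets M"
      using part_meets[OF PQ(2)] partition_sets[OF PQ(1)] partition_not_null[OF PQ(1)] AB by blast
    obtain B' where B': "B' \<in> Q" "B' \<inter> B \<notin> null_sets M"
      using part_meets[OF PQ(2)] partition_sets[OF PQ(1)] partition_not_null[OF PQ(1)] AB by blast
    have "graph_dist (upper_edges M \<kappa> P) A B \<le> graph_dist (lower_edges M \<kappa> Q) A' B'"
      unfolding graph_dist_def
    \<comment> \<open>Every lower length is also an upper length, and a larger set of lengths has a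
      smaller infimum; an empty set of lower lengths gives the value \<infinity>.\<close>
    proof (rule INF_superset_mono)
      show "{n. 1 \<le> n \<and> (A', B') \<in> lower_edges M \<kappa> Q ^^ n}
          \<subseteq> {n. 1 \<le> n \<and> (A, B) \<in> upper_edges M \<kappa> P ^^ n}"
      proof
        fix n assume "n \<in> {n. 1 \<le> n \<and> (A', B') \<in> lower_edges M \<kappa> Q ^^ n}"
        then have n: "1 \<le> n" "(A', B') \<in> lower_edges M \<kappa> Q ^^ n"
          by auto
        then obtain m where "n = Suc m"
          by (cases n) auto
        then have "(A, B) \<in> upper_edges M \<kappa> P ^^ n"
          using lower_walk_imp_upper_walk[OF PQ, of A' B' m A B] n A' B' AB
          by (metis Int_commute)
        then show "n \<in> {n. 1 \<le> n \<and> (A, B) \<in> upper_edges M \<kappa> P ^^ n}"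
          using n by simp
      qed
    qed simp
    also have "\<dots> \<le> graph_diam Q (lower_edges M \<kappa> Q)"
      unfolding graph_diam_def using A' B' by (meson SUP_upper SUP_upper2)
    finally show ?thesis .
  qed
  then have "graph_diam P (upper_edges M \<kappa> P) \<le> graph_diam Q (lower_edges M \<kappa> Q)"
    if "positive_partition M P" "positive_partition M Q" for P Q
    using that by (subst graph_diam_def) (intro SUP_least, blast)
  then show ?thesis
    unfolding Delta_upper_def Delta_lower_def by (intro SUP_least INF_greatest) auto
qed

end

section \<open>Rectangle covers, iterated neighbourhoods and chains\<close>

text \<open>The rectangles record what continuity contributes. Their sides are only required to be
  measurable, and the lower bound holds at every point, so it passes to all subrectangles.\<close>

locale rectangle_kernel = nonneg_kernel M \<kappa>
  for M :: "'a::{metric_space, second_countable_topology} measure" and \<kappa> :: "'a \<times> 'a \<Rightarrow> real" +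
  fixes R :: "('a set \<times> 'a set) set"
  assumes countable_R: "countable R"
    and rectangle_sets: "(U, V) \<in> R \<Longrightarrow> U \<in> sets M \<and> V \<in> sets M"
    and rectangle_lower: "(U, V) \<in> R \<Longrightarrow> \<exists>c>0. \<forall>z\<in>U \<times> V. c \<le> \<kappa> z"
    and rectangle_cover: "AE z in M \<Otimes>\<^sub>M M. 0 < \<kappa> z \<longrightarrow> (\<exists>(U, V)\<in>R. z \<in> U \<times> V)"
begin

text \<open>Only rectangles whose first side meets \<open>B\<close> in positive measure count, so
  changing \<open>B\<close> by a null set does not change its neighbourhood.\<close>

definition nbhd :: "'a set \<Rightarrow> 'a set" where
  "nbhd B = \<Union>(snd ` {(U, V) \<in> R. B \<inter> U \<notin> null_sets M})"

lemma sets_nbhd_iter: "B \<in> sets M \<Longrightarrow> (nbhd ^^ n) B \<in> sets M"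
proof (induction n)
  case (Suc n)
  let ?R = "{(U, V) \<in> R. (nbhd ^^ n) B \<inter> U \<notin> null_sets M}"
  have "countable ?R"
    by (rule countable_subset[OF _ countable_R]) auto
  moreover have "snd ` ?R \<subseteq> sets M"
    using rectangle_sets by auto
  ultimately have "\<Union>(snd ` ?R) \<in> sets M"
    by (intro sets.countable_Union) auto
  then show ?case
    by (simp add: nbhd_def[of "(nbhd ^^ n) B"])
qed simp

text \<open>The neighbourhood is a countable union, so one of its sets \<open>V\<close> must already
  meet \<open>W\<close> in positive measure.\<close>

lemma nbhd_meets:
  assumes "nbhd B \<inter> W \<notin> null_sets M"
  shows "\<exists>(U, V)\<in>R. B \<inter> U \<notin> null_sets M \<and> V \<inter> W \<notin> null_sets M"
proof (rule ccontr)
  let ?R = "{(U, V) \<in> R. B \<inter> U \<notin> null_sets M}"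
  assume "\<not> ?thesis"
  then have "(\<Union>p\<in>?R. snd p \<inter> W) \<in> null_sets M"
    using countable_R by (intro null_sets_UN') (auto intro: countable_subset)
  then show False
    using assms by (simp add: nbhd_def Int_UN_distrib2)
qed

text \<open>Otherwise every rectangle of \<open>R\<close> meets \<open>A \<times> B\<close> in a
  null set; as countably many of them cover the positivity set up to a null set, the kernel would
  vanish almost everywhere on \<open>A \<times> B\<close>.\<close>

lemma upper_edge_rectangle:
  assumes "kernel_upper M \<kappa> A B > 0" "A \<in> sets M" "B \<in> sets M"
  shows "\<exists>(U, V)\<in>R. A \<inter> U \<notin> null_sets M \<and> B \<inter> V \<notin> null_sets M"
proof (rule ccontr)
  assume "\<not> ?thesis"
  then have "(A \<inter> U) \<times> (B \<inter> V) \<in> null_sets (M \<Otimes>\<^sub>M M)" if "(U, V) \<in> R" for U V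
    using that rectangle_sets[OF that] assms(2,3) by (subst rectangle_null_iff) auto
  then have "(\<Union>p\<in>R. (A \<inter> fst p) \<times> (B \<inter> snd p)) \<in> null_sets (M \<Otimes>\<^sub>M M)"
    using countable_R by (intro null_sets_UN') auto
  from AE_not_in[OF this] rectangle_cover
  have "AE z in M \<Otimes>\<^sub>M M. z \<in> A \<times> B \<longrightarrow> \<kappa> z = 0"
  proof eventually_elim
    case (elim z)
    then show ?case
      using kernel_nonneg[of z] by (fastforce simp: less_le)
  qed
  then show False
    using assms kernel_upper_pos_iff by auto
qed

text \<open>Since each part is almost inside or almost outside every iterate, a part that meets an
  iterate is almost contained in it. A rectangle that starts in this part then also starts in the
  iterate, and ends in the next one.\<close>

lemma upper_walk_meets_nbhd:
  assumes P: "positive_partition M P" and "A \<in> P" "A - B \<in> null_sets M" "B \<in> sets M"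
    and decided: "\<And>C t. C \<in> P \<Longrightarrow> t \<le> n \<Longrightarrow>
      C - (nbhd ^^ t) B \<in> null_sets M \<or> C \<inter> (nbhd ^^ t) B \<in> null_sets M"
  shows "(A, C) \<in> upper_edges M \<kappa> P ^^ n \<Longrightarrow> C \<inter> (nbhd ^^ n) B \<notin> null_sets M"
  using decided
proof (induction n arbitrary: C)
  case 0
  then show ?case
    using assms not_null_almost_subset partition_sets[OF P] partition_not_null[OF P] by simp
next
  case (Suc n)
  let ?N = "(nbhd ^^ n) B"
  obtain D where D: "(A, D) \<in> upper_edges M \<kappa> P ^^ n" "(D, C) \<in> upper_edges M \<kappa> P"
    using Suc.prems(1) by auto
  then have DC: "D \<in> P" "C \<in> P" "kernel_upper M \<kappa> D C > 0"
    by (auto simp: upper_edges_def)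
  then have sets: "D \<in> sets M" "C \<in> sets M" "?N \<in> sets M" "nbhd ?N \<in> sets M"
    using partition_sets[OF P] sets_nbhd_iter[OF assms(4), of n] sets_nbhd_iter[OF assms(4), of "Suc n"]
    by auto
  have "D \<inter> ?N \<notin> null_sets M"
    using Suc.IH[OF D(1)] Suc.prems(2) by simp
  \<comment> \<open>Merely meeting \<open>?N\<close> would not suffice: the rectangle found next
    could start in \<open>D\<close> outside \<open>?N\<close>.\<close>
  then have DN: "D - ?N \<in> null_sets M"
    using Suc.prems(2)[OF DC(1), of n] by auto
  obtain U V where UV: "(U, V) \<in> R" "D \<inter> U \<notin> null_sets M" "C \<inter> V \<notin> null_sets M"
    using upper_edge_rectangle[OF DC(3)] sets by blast
  have "?N \<inter> U \<notin> null_sets M"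
  proof
    assume "?N \<inter> U \<in> null_sets M"
    then have *: "(?N \<inter> U) \<union> (D - ?N) \<in> null_sets M"
      using DN by blast
    have "D \<inter> U \<in> null_sets M"
      by (rule null_sets_subset[OF *]) (use sets rectangle_sets[OF UV(1)] in auto)
    then show False
      using UV by simp
  qed
  then have "V \<subseteq> nbhd ?N"
    using UV(1) by (force simp: nbhd_def)
  then show ?case
    using UV(3) rectangle_sets[OF UV(1)] sets not_null_mono[of "C \<inter> nbhd ?N" "C \<inter> V"] by auto
qed

text \<open>The index \<open>n\<close> counts edges, so there are \<open>n + 1\<close> sets, which
  may overlap or repeat. Values of \<open>W\<close> beyond \<open>n\<close> are unconstrained, so a
  chain is extended by a function update.\<close>

definition chain :: "nat \<Rightarrow> (nat \<Rightarrow> 'a set) \<Rightarrow> bool" where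
  "chain n W \<longleftrightarrow> (\<forall>i\<le>n. W i \<in> sets M \<and> W i \<notin> null_sets M) \<and>
     (\<forall>i<n. kernel_lower M \<kappa> (W i) (W (Suc i)) > 0)"

text \<open>The last rectangle \<open>(U, V)\<close> is found first: the induction hypothesis is
  aimed at \<open>U\<close> as new target, and \<open>V \<inter> B'\<close> is appended. The
  pointwise bound on \<open>U \<times> V\<close> gives the last edge.\<close>

lemma exists_chain:
  "B \<in> sets M \<Longrightarrow> B' \<in> sets M \<Longrightarrow> (nbhd ^^ n) B \<inter> B' \<notin> null_sets M \<Longrightarrow>
    \<exists>W. chain n W \<and> W 0 \<subseteq> B \<and> W n \<subseteq> B'"
proof (induction n arbitrary: B')
  case 0
  then show ?case
    by (intro exI[of _ "\<lambda>_. B \<inter> B'"]) (auto simp: chain_def)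
next
  case (Suc n)
  obtain U V where UV: "(U, V) \<in> R" "(nbhd ^^ n) B \<inter> U \<notin> null_sets M" "V \<inter> B' \<notin> null_sets M"
    using nbhd_meets[of "(nbhd ^^ n) B" B'] Suc.prems(3) by auto
  then have sets: "U \<in> sets M" "V \<in> sets M"
    using rectangle_sets by auto
  obtain W where W: "chain n W" "W 0 \<subseteq> B" "W n \<subseteq> U"
    using Suc.IH[OF Suc.prems(1) sets(1) UV(2)] by auto
  obtain c where "c > 0" "\<forall>z\<in>U \<times> V. c \<le> \<kappa> z"
    using rectangle_lower[OF UV(1)] by blast
  then have "AE z in M \<Otimes>\<^sub>M M. z \<in> W n \<times> (V \<inter> B') \<longrightarrow> c \<le> \<kappa> z"
    using W(3) by (intro AE_I2) auto
  moreover have "W n \<in> sets M"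
    using W(1) by (simp add: chain_def)
  ultimately have "kernel_lower M \<kappa> (W n) (V \<inter> B') > 0"
    using \<open>c > 0\<close> sets Suc.prems(2) by (subst kernel_lower_pos_iff) auto
  then have "chain (Suc n) (W(Suc n := V \<inter> B'))"
    using W(1) UV(3) sets Suc.prems(2) by (auto simp: chain_def le_Suc_eq less_Suc_eq)
  then show ?case
    using W(2) by (intro exI[of _ "W(Suc n := V \<inter> B')"]) (simp del: fun_upd_apply, simp)
qed

text \<open>An upper walk between a part almost inside \<open>B\<close> and a part almost inside
  \<open>B'\<close> has some length \<open>n\<close> between 1 and \<open>D\<close>; it shows that
  the \<open>n\<close>-th iterate meets \<open>B'\<close>, and a chain can be traced back.\<close>

lemma exists_short_chain:
  assumes "\<Delta>\<^sub>u M \<kappa> \<le> enat D"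
    and B: "B \<in> sets M" "B \<notin> null_sets M" "B' \<in> sets M" "B' \<notin> null_sets M"
  shows "\<exists>n W. 1 \<le> n \<and> n \<le> D \<and> chain n W \<and> W 0 \<subseteq> B \<and> W n \<subseteq> B'"
proof -
  \<comment> \<open>The index \<open>t = 0\<close> contributes \<open>B\<close> itself, so the
    partition decides \<open>B\<close>, \<open>B'\<close> and all iterates that a walk of length at
    most \<open>D\<close> can reach.\<close>
  let ?F = "insert B' ((\<lambda>t. (nbhd ^^ t) B) ` {..D})"
  have "finite ?F" "?F \<subseteq> sets M"
    using B sets_nbhd_iter by auto
  then obtain P where P: "positive_partition M P"
    and dec: "\<And>C S. C \<in> P \<Longrightarrow> S \<in> ?F \<Longrightarrow> C - S \<in> null_sets M \<or> C \<inter> S \<in> null_sets M"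
    using exists_refining_partition[of ?F] by blast
  obtain A where A: "A \<in> P" "A \<inter> B \<notin> null_sets M"
    using part_meets[OF P] B by blast
  then have AB: "A - B \<in> null_sets M"
    using dec[of A B] image_eqI[of B "\<lambda>t. (nbhd ^^ t) B" 0 "{..D}"] by auto
  obtain C where C: "C \<in> P" "C \<inter> B' \<notin> null_sets M"
    using part_meets[OF P] B by blast
  then have CB: "C - B' \<in> null_sets M"
    using dec[of C B'] by auto
  have "graph_dist (upper_edges M \<kappa> P) A C \<le> graph_diam P (upper_edges M \<kappa> P)"
    unfolding graph_diam_def using A C by (meson SUP_upper SUP_upper2)
  also have "\<dots> \<le> \<Delta>\<^sub>u M \<kappa>"
    unfolding Delta_upper_def using P by (intro SUP_upper) simp
  \<comment> \<open>A strict bound on the infimum yields an actual walk, of length at most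
    \<open>D\<close>.\<close>
  also have "\<dots> < enat (Suc D)"
    using assms(1) by (simp add: order_le_less_trans)
  finally obtain n where n: "1 \<le> n" "(A, C) \<in> upper_edges M \<kappa> P ^^ n" "n \<le> D"
    unfolding graph_dist_def INF_less_iff by auto
  have "C \<inter> (nbhd ^^ n) B \<notin> null_sets M"
    using upper_walk_meets_nbhd[OF P A(1) AB B(1) _ n(2)] dec n(3) by auto
  have "(nbhd ^^ n) B \<inter> B' \<notin> null_sets M"
  proof
    assume "(nbhd ^^ n) B \<inter> B' \<in> null_sets M"
    then have *: "((nbhd ^^ n) B \<inter> B') \<union> (C - B') \<in> null_sets M"
      using CB by blast
    have "C \<inter> (nbhd ^^ n) B \<in> null_sets M"
      by (rule null_sets_subset[OF *]) (use B sets_nbhd_iter partition_sets[OF P] C in auto)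
    then show False
      using \<open>C \<inter> (nbhd ^^ n) B \<notin> null_sets M\<close> by simp
  qed
  then show ?thesis
    using exists_chain[OF B(1,3)] n(1,3) by meson
qed

text \<open>Every part first steps into a neighbour, then follows a chain of length at most \<open>\<Delta>\<^sub>u\<close>, and
  a last step leads from a neighbour into the target.\<close>

lemma Delta_lower_le_of_no_isolated_part:
  assumes Q: "positive_partition M Q"
    and out: "\<And>A. A \<in> Q \<Longrightarrow> \<exists>B. (A, B) \<in> lower_edges M \<kappa> Q"
    and inn: "\<And>A. A \<in> Q \<Longrightarrow> \<exists>B. (B, A) \<in> lower_edges M \<kappa> Q"
  shows "\<Delta>\<^sub>l M \<kappa> \<le> \<Delta>\<^sub>u M \<kappa> + 2"
proof (cases "\<Delta>\<^sub>u M \<kappa>")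
  case (enat D)
  obtain succ where succ: "\<And>A. A \<in> Q \<Longrightarrow> (A, succ A) \<in> lower_edges M \<kappa> Q"
    using out by metis
  obtain pred where pred: "\<And>A. A \<in> Q \<Longrightarrow> (pred A, A) \<in> lower_edges M \<kappa> Q"
    using inn by metis
  have succ_pred: "succ A \<in> Q" "pred A \<in> Q" if "A \<in> Q" for A
    using succ[OF that] pred[OF that] by (auto simp: lower_edges_def)
  have "\<exists>n W. 1 \<le> n \<and> n \<le> D \<and> chain n W \<and> W 0 \<subseteq> succ A \<and> W n \<subseteq> pred A'"
    if "A \<in> Q" "A' \<in> Q" for A A'
    using that succ_pred partition_sets[OF Q] partition_not_null[OF Q] enat
    by (intro exists_short_chain) auto
  then obtain len W where
    W: "\<And>A A'. A \<in> Q \<Longrightarrow> A' \<in> Q \<Longrightarrow> 1 \<le> len A A' \<and> len A A' \<le> D \<and> chain (len A A') (W A A') \<and>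
      W A A' 0 \<subseteq> succ A \<and> W A A' (len A A') \<subseteq> pred A'"
    by metis
  \<comment> \<open>Including \<open>Q\<close> makes every part of the refinement almost contained
    in a part of \<open>Q\<close>; including the chain sets provides a part almost inside each of
    them.\<close>
  define F where "F = Q \<union> (\<Union>A\<in>Q. \<Union>A'\<in>Q. W A A' ` {..len A A'})"
  have "finite Q"
    using Q by (simp add: positive_partition_def)
  then have "finite F"
    by (simp add: F_def)
  have "F \<subseteq> sets M"
    using W partition_sets[OF Q] by (fastforce simp: F_def chain_def)
  obtain P where P: "positive_partition M P"
    and dec: "\<And>C S. C \<in> P \<Longrightarrow> S \<in> F \<Longrightarrow> C - S \<in> null_sets M \<or> C \<inter> S \<in> null_sets M"
    using exists_refining_partition[OF \<open>finite F\<close> \<open>F \<subseteq> sets M\<close>] by auto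
  have refine: "(C, C') \<in> lower_edges M \<kappa> P"
    if "kernel_lower M \<kappa> A A' > 0" "A \<in> sets M" "A' \<in> sets M" "C \<in> P" "C' \<in> P"
      "C - A \<in> null_sets M" "C' - A' \<in> null_sets M" for A A' C C'
    using kernel_lower_pos_mono[OF that(1-3) _ _ that(6,7)] that(4,5) partition_sets[OF P]
    by (simp add: lower_edges_def)
  have "graph_dist (lower_edges M \<kappa> P) C C' \<le> enat (D + 2)" if C: "C \<in> P" and C': "C' \<in> P" for C C'
  proof -
    obtain A where A: "A \<in> Q" "A \<inter> C \<notin> null_sets M"
      using part_meets[OF Q] partition_sets[OF P C] partition_not_null[OF P C] by blast
    obtain A' where A': "A' \<in> Q" "A' \<inter> C' \<notin> null_sets M"
      using part_meets[OF Q] partition_sets[OF P C'] partition_not_null[OF P C'] by blast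
    have CA: "C - A \<in> null_sets M" "C' - A' \<in> null_sets M"
      using dec[OF C, of A] dec[OF C', of A'] A A' by (auto simp: F_def Int_commute)
    define n where "n = len A A'"
    define w where "w = W A A'"
    have w: "1 \<le> n" "n \<le> D" "w 0 \<subseteq> succ A" "w n \<subseteq> pred A'"
      "\<And>i. i \<le> n \<Longrightarrow> w i \<in> sets M" "\<And>i. i \<le> n \<Longrightarrow> w i \<notin> null_sets M"
      "\<And>i. i < n \<Longrightarrow> kernel_lower M \<kappa> (w i) (w (Suc i)) > 0"
      using W[OF A(1) A'(1)] by (auto simp: chain_def n_def w_def)
    have "\<exists>Z\<in>P. Z - w i \<in> null_sets M" if i: "i \<le> n" for i
    proof -
      obtain Z where "Z \<in> P" "Z \<inter> w i \<notin> null_sets M"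
        using part_meets[OF P w(5,6)[OF i]] by blast
      moreover have "w i \<in> F"
        using A A' i by (auto simp: F_def n_def w_def)
      ultimately show ?thesis
        using dec by blast
    qed
    then obtain Z where Z: "\<And>i. i \<le> n \<Longrightarrow> Z i \<in> P" "\<And>i. i \<le> n \<Longrightarrow> Z i - w i \<in> null_sets M"
      by metis
    have "(Z i, Z (Suc i)) \<in> lower_edges M \<kappa> P" if "i < n" for i
      using that w Z by (intro refine[of "w i" "w (Suc i)"]) auto
    then have "(Z 0, Z n) \<in> lower_edges M \<kappa> P ^^ n"
      unfolding relpow_fun_conv by blast
    moreover have "(C, Z 0) \<in> lower_edges M \<kappa> P"
    proof (rule refine)
      show "kernel_lower M \<kappa> A (succ A) > 0"
        using succ[OF A(1)] by (simp add: lower_edges_def)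
      show s: "succ A \<in> sets M"
        using succ_pred partition_sets[OF Q] A by simp
      show "Z 0 - succ A \<in> null_sets M"
        by (rule null_sets_subset[OF Z(2)[of 0]]) (use w(3) s partition_sets[OF P Z(1)[of 0]] in auto)
    qed (use CA Z C A partition_sets[OF Q] in auto)
    moreover have "(Z n, C') \<in> lower_edges M \<kappa> P"
    proof (rule refine)
      show "kernel_lower M \<kappa> (pred A') A' > 0"
        using pred[OF A'(1)] by (simp add: lower_edges_def)
      show s: "pred A' \<in> sets M"
        using succ_pred partition_sets[OF Q] A' by simp
      show "Z n - pred A' \<in> null_sets M"
        by (rule null_sets_subset[OF Z(2)[of n]]) (use w(4) s partition_sets[OF P Z(1)[of n]] in auto)
    qed (use CA Z C' A' partition_sets[OF Q] in auto)
    \<comment> \<open>The two extra edges are the first step into \<open>succ A\<close> and the last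
      step out of \<open>pred A'\<close>.\<close>
    ultimately have "(C, C') \<in> lower_edges M \<kappa> P ^^ (n + 2)"
      by (metis add_2_eq_Suc' relpow_Suc_I relpow_Suc_I2)
    then have "graph_dist (lower_edges M \<kappa> P) C C' \<le> enat (n + 2)"
      unfolding graph_dist_def by (intro INF_lower) simp
    also have "\<dots> \<le> enat (D + 2)"
      using w(2) by simp
    finally show ?thesis .
  qed
  then have "graph_diam P (lower_edges M \<kappa> P) \<le> enat (D + 2)"
    unfolding graph_diam_def by (intro SUP_least)
  moreover have "\<Delta>\<^sub>l M \<kappa> \<le> graph_diam P (lower_edges M \<kappa> P)"
    unfolding Delta_lower_def using P by (intro INF_lower) simp
  ultimately show ?thesis
    using enat by (simp add: numeral_eq_enat order.trans)
qed simp

end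

section \<open>The rectangle cover from continuity, and the bound
  \<open>\<Delta>\<^sub>l \<le> \<Delta>\<^sub>u + 2\<close>\<close>

text \<open>Around a continuity point \<open>z\<close> with \<open>\<kappa> z > 0\<close> the kernel
  exceeds \<open>\<kappa> z / 2\<close> on a product of basic open sets, and a countable basis has
  only countably many such products.\<close>

lemma (in nonneg_kernel) countable_rectangle_cover:
  assumes "AE z in M \<Otimes>\<^sub>M M. isCont \<kappa> z"
  shows "\<exists>R. rectangle_kernel M \<kappa> R"
proof -
  obtain B :: "'a set set" where B: "countable B" "topological_basis B"
    using ex_countable_basis by blast
  define R where "R = {(U, V) \<in> B \<times> B. \<exists>c>0. \<forall>z\<in>U \<times> V. c \<le> \<kappa> z}"
  have "countable R"
    unfolding R_def using B(1) by (auto intro: countable_subset[of _ "B \<times> B"])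
  moreover have "U \<in> sets M \<and> V \<in> sets M" if "(U, V) \<in> R" for U V
    using that topological_basis_open[OF B(2)] by (auto simp: R_def sets_eq_borel)
  moreover have "AE z in M \<Otimes>\<^sub>M M. 0 < \<kappa> z \<longrightarrow> (\<exists>(U, V)\<in>R. z \<in> U \<times> V)"
    using assms
  proof (eventually_elim, intro impI)
    fix z assume cont: "isCont \<kappa> z" and pos: "0 < \<kappa> z"
    have "((\<lambda>w. \<kappa> w) \<longlongrightarrow> \<kappa> z) (nhds z)"
      using cont by (simp add: isCont_def tendsto_at_iff_tendsto_nhds)
    then have "eventually (\<lambda>w. \<kappa> z / 2 < \<kappa> w) (nhds z)"
      by (rule order_tendstoD) (use pos in simp)
    then obtain S where S: "open S" "z \<in> S" "\<And>w. w \<in> S \<Longrightarrow> \<kappa> z / 2 < \<kappa> w"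
      unfolding eventually_nhds by blast
    obtain X Y where XY: "open X" "open Y" "z \<in> X \<times> Y" "X \<times> Y \<subseteq> S"
      by (rule open_prod_elim[OF S(1,2)])
    obtain U where U: "U \<in> B" "fst z \<in> U" "U \<subseteq> X"
      using topological_basisE[OF B(2) XY(1), of "fst z"] XY(3) by (auto simp: mem_Times_iff)
    obtain V where V: "V \<in> B" "snd z \<in> V" "V \<subseteq> Y"
      using topological_basisE[OF B(2) XY(2), of "snd z"] XY(3) by (auto simp: mem_Times_iff)
    have "U \<times> V \<subseteq> S"
      using XY(4) U(3) V(3) by blast
    then have "\<forall>w\<in>U \<times> V. \<kappa> z / 2 \<le> \<kappa> w"
      using S(3) less_imp_le by blast
    then have "(U, V) \<in> R"
      using U V pos by (auto simp: R_def intro!: exI[of _ "\<kappa> z / 2"])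
    then show "\<exists>(U, V)\<in>R. z \<in> U \<times> V"
      using U V by (auto simp: mem_Times_iff)
  qed
  ultimately have "rectangle_kernel M \<kappa> R"
    by unfold_locales (auto simp: R_def)
  then show ?thesis ..
qed

text \<open>The distance from a vertex to itself counts only walks of positive length, so finiteness
  gives a closed walk through \<open>v\<close>, whose first and last edges supply the
  neighbours.\<close>

lemma graph_diam_finite_imp_no_isolated:
  assumes "graph_diam V E < \<infinity>" "v \<in> V"
  shows "\<exists>w. (v, w) \<in> E" "\<exists>w. (w, v) \<in> E"
proof -
  have "graph_dist E v v \<le> graph_diam V E"
    unfolding graph_diam_def using assms(2) by (meson SUP_upper SUP_upper2)
  then have "graph_dist E v v < \<infinity>"
    using assms(1) by (rule order.strict_trans1)
  then obtain n where "1 \<le> n" "(v, v) \<in> E ^^ n"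
    unfolding graph_dist_def INF_less_iff by auto
  then obtain m where m: "(v, v) \<in> E ^^ Suc m"
    by (cases n) auto
  then show "\<exists>w. (v, w) \<in> E" "\<exists>w. (w, v) \<in> E"
    using relpow_Suc_D2[OF m] by (auto elim: relpow_Suc_E)
qed

lemma admissible_imp_nonneg_kernel:
  assumes "admissible_kernel M \<kappa>"
  shows "nonneg_kernel M \<kappa>"
  using assms by (simp add: admissible_kernel_def nonneg_kernel_def nonneg_kernel_axioms_def)

lemma Delta_lower_le_Delta_upper_plus_2:
  assumes "admissible_kernel M \<kappa>" "\<Delta>\<^sub>l M \<kappa> < \<infinity>"
  shows "\<Delta>\<^sub>l M \<kappa> \<le> \<Delta>\<^sub>u M \<kappa> + 2"
proof -
  interpret nonneg_kernel M \<kappa>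
    by (rule admissible_imp_nonneg_kernel[OF assms(1)])
  obtain R where "rectangle_kernel M \<kappa> R"
    using countable_rectangle_cover assms(1) by (auto simp: admissible_kernel_def)
  then interpret rectangle_kernel M \<kappa> R .
  obtain Q where Q: "positive_partition M Q" "graph_diam Q (lower_edges M \<kappa> Q) < \<infinity>"
    using assms(2) unfolding Delta_lower_def INF_less_iff by blast
  show ?thesis
    using Delta_lower_le_of_no_isolated_part[OF Q(1)] graph_diam_finite_imp_no_isolated[OF Q(2)]
    by blast
qed

section \<open>Tools for the two examples\<close>

context nonneg_kernel
begin

text \<open>The one-part partition already shows this, since self-distances are at least 1.\<close>

lemma one_le_Delta_upper: "1 \<le> \<Delta>\<^sub>u M \<kappa>"
proof -
  let ?E = "upper_edges M \<kappa> {space M}"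
  have "1 \<le> graph_dist ?E (space M) (space M)"
    unfolding graph_dist_def by (intro INF_greatest) (simp add: one_enat_def)
  also have "\<dots> = graph_diam {space M} ?E"
    by (simp add: graph_diam_def)
  also have "\<dots> \<le> \<Delta>\<^sub>u M \<kappa>"
    unfolding Delta_upper_def using positive_partition_space by (intro SUP_upper) simp
  finally show ?thesis .
qed

lemma Delta_upper_le_one:
  assumes "\<And>z. 0 < \<kappa> z"
  shows "\<Delta>\<^sub>u M \<kappa> \<le> 1"
proof -
  have "graph_dist (upper_edges M \<kappa> P) A B \<le> 1"
    if P: "positive_partition M P" and AB: "A \<in> P" "B \<in> P" for P A B
  proof -
    have s: "A \<in> sets M" "B \<in> sets M"
      using partition_sets[OF P] AB by auto
    have "\<not> (AE z in M \<Otimes>\<^sub>M M. z \<in> A \<times> B \<longrightarrow> \<kappa> z = 0)"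
    proof
      assume "AE z in M \<Otimes>\<^sub>M M. z \<in> A \<times> B \<longrightarrow> \<kappa> z = 0"
      then have "AE z in M \<Otimes>\<^sub>M M. z \<notin> A \<times> B"
        by eventually_elim (use assms in \<open>auto simp: less_le\<close>)
      then have "A \<times> B \<in> null_sets (M \<Otimes>\<^sub>M M)"
        using s by (subst AE_iff_null_sets) auto
      then show False
        using s AB partition_not_null[OF P] rectangle_null_iff by blast
    qed
    then have "(A, B) \<in> upper_edges M \<kappa> P"
      using AB s kernel_upper_pos_iff by (simp add: upper_edges_def)
    then show ?thesis
      unfolding graph_dist_def one_enat_def by (intro INF_lower) simp
  qed
  then show ?thesis
    unfolding Delta_upper_def graph_diam_def by (intro SUP_least) auto
qed

lemma degree_ge:
  assumes "\<And>z. \<kappa> z \<le> 1" "A \<in> sets M" "\<And>y. y \<in> A \<Longrightarrow> c \<le> \<kappa> (x, y)"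
  shows "c * prob A \<le> kernel_degree M \<kappa> x"
proof -
  have x: "x \<in> space M"
    using sets_eq_imp_space_eq[OF sets_eq_borel] by simp
  have "c * prob A = (\<integral>y. c * indicator A y \<partial>M)"
    using assms(2) by simp
  also have "\<dots> \<le> (\<integral>y. \<kappa> (x, y) \<partial>M)"
  proof (rule integral_mono)
    show "integrable M (\<lambda>y. \<kappa> (x, y))"
      using assms(1) kernel_nonneg x by (intro integrable_const_bound[where B=1]) auto
    show "integrable M (\<lambda>y. c * indicator A y)"
      using assms(2) by (intro integrable_mult_right integrable_real_indicator) (auto simp: less_top[symmetric])
  qed (use assms kernel_nonneg in \<open>auto simp: indicator_def\<close>)
  finally show ?thesis
    by (simp add: kernel_degree_def)
qed

lemma irreducible_if_positive:
  assumes "\<And>z. 0 < \<kappa> z"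
  shows "irreducible_kernel M \<kappa>"
  unfolding irreducible_kernel_def
proof clarify
  fix A assume A: "A \<in> sets M" "0 < prob A" "prob A < 1"
    and "AE z in M \<Otimes>\<^sub>M M. z \<in> A \<times> (space M - A) \<longrightarrow> \<kappa> z = 0"
  then have "AE z in M \<Otimes>\<^sub>M M. z \<notin> A \<times> (space M - A)"
    by (elim eventually_mono) (use assms in \<open>auto simp: less_le\<close>)
  then have "A \<times> (space M - A) \<in> null_sets (M \<Otimes>\<^sub>M M)"
    using A by (subst AE_iff_null_sets) auto
  moreover have "0 < prob (space M - A)"
    using A by (simp add: prob_compl)
  ultimately show False
    using A rectangle_null_iff[of A "space M - A"] pos_iff_not_null by auto
qed

lemma min_degree_pos:
  assumes "0 < d" "\<And>x. d \<le> kernel_degree M \<kappa> x"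
  shows "0 < min_degree M \<kappa>"
proof -
  have "(\<lambda>x. kernel_degree M \<kappa> x) \<in> borel_measurable M"
    unfolding kernel_degree_def by measurable
  then have "esssup M (\<lambda>x. - ereal (kernel_degree M \<kappa> x)) \<le> - ereal d"
    using assms(2) by (intro esssup_I) auto
  then have "ereal d \<le> min_degree M \<kappa>"
    unfolding min_degree_def essinf_def by (metis ereal_minus_le_minus ereal_uminus_uminus)
  then show ?thesis
    using assms(1) by (meson ereal_less(2) less_le_trans)
qed

text \<open>Serves to refute lower edges. The constant is fixed before \<open>X\<close> and
  \<open>Y\<close>, so these may be chosen as far out in a tail as \<open>c\<close> demands.\<close>

lemma kernel_lower_pos_null_rectangle:
  assumes "kernel_lower M \<kappa> A B > 0" "A \<in> sets M" "B \<in> sets M"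
  obtains c where "c > 0"
    and "\<And>X Y. X \<in> sets M \<Longrightarrow> Y \<in> sets M \<Longrightarrow> X \<subseteq> A \<Longrightarrow> Y \<subseteq> B \<Longrightarrow> (\<And>z. z \<in> X \<times> Y \<Longrightarrow> \<kappa> z < c) \<Longrightarrow>
      X \<in> null_sets M \<or> Y \<in> null_sets M"
proof -
  obtain c where c: "c > 0" "AE z in M \<Otimes>\<^sub>M M. z \<in> A \<times> B \<longrightarrow> c \<le> \<kappa> z"
    using assms kernel_lower_pos_iff by auto
  have "X \<in> null_sets M \<or> Y \<in> null_sets M"
    if XY: "X \<in> sets M" "Y \<in> sets M" "X \<subseteq> A" "Y \<subseteq> B" "\<And>z. z \<in> X \<times> Y \<Longrightarrow> \<kappa> z < c" for X Y
  proof -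
    have "AE z in M \<Otimes>\<^sub>M M. z \<notin> X \<times> Y"
      using c(2) by eventually_elim (use XY in \<open>auto simp: not_le[symmetric]\<close>)
    then have "X \<times> Y \<in> null_sets (M \<Otimes>\<^sub>M M)"
      using XY by (subst AE_iff_null_sets) auto
    then show ?thesis
      using XY rectangle_null_iff by blast
  qed
  with c(1) show thesis
    by (rule that)
qed

text \<open>If every part \<open>C\<close> failed at some index \<open>k C\<close>, then all of the
  finitely many parts would fail at the largest of these indices, against
  \<open>part_meets\<close>.\<close>

lemma part_meets_decreasing:
  assumes P: "positive_partition M P"
    and W: "decseq W" "\<And>n. W n \<in> sets M" "\<And>n. W n \<notin> null_sets M"
  shows "\<exists>C\<in>P. \<forall>n::nat. C \<inter> W n \<notin> null_sets M"
proof (rule ccontr)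
  assume "\<not> ?thesis"
  then obtain k where k: "\<And>C. C \<in> P \<Longrightarrow> C \<inter> W (k C) \<in> null_sets M"
    by metis
  have "finite P"
    using P by (simp add: positive_partition_def)
  then have le: "k C \<le> Max (k ` P)" if "C \<in> P" for C
    using that by simp
  obtain C where C: "C \<in> P" "C \<inter> W (Max (k ` P)) \<notin> null_sets M"
    using part_meets[OF P W(2,3)] by blast
  have "C \<inter> W (Max (k ` P)) \<in> null_sets M"
    by (rule null_sets_subset[OF k[OF C(1)]])
      (use W partition_sets[OF P C(1)] decseqD[OF W(1) le[OF C(1)]] in auto)
  then show False
    using C(2) by simp
qed

end

text \<open>Second countability identifies the product of the Borel algebras with the Borel algebra
  of the product, so continuity gives measurability.\<close>

lemma nonneg_kernel_if_continuous:
  fixes M :: "'a::{metric_space, second_countable_topology} measure"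
  assumes "prob_space M" "sets M = sets borel" "continuous_on UNIV \<kappa>" "\<And>z. 0 \<le> \<kappa> z"
  shows "nonneg_kernel M \<kappa>"
proof -
  have "\<kappa> \<in> borel_measurable (borel \<Otimes>\<^sub>M borel)"
    using borel_measurable_continuous_onI[OF assms(3)] by (simp add: borel_prod)
  then have "\<kappa> \<in> borel_measurable (M \<Otimes>\<^sub>M M)"
    using assms(2) by (simp cong: measurable_cong_sets)
  then show ?thesis
    using assms by (simp add: nonneg_kernel_def nonneg_kernel_axioms_def)
qed

lemma admissible_kernelI:
  fixes M :: "'a::{metric_space, second_countable_topology} measure"
  assumes "prob_space M" "sets M = sets borel"
    and cont: "continuous_on UNIV \<kappa>" and pos: "\<And>z. 0 < \<kappa> z" and le: "\<And>z. \<kappa> z \<le> 1"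
    and sym: "\<And>x y. \<kappa> (x, y) = \<kappa> (y, x)"
    and deg: "0 < d" "\<And>x. d \<le> kernel_degree M \<kappa> x"
  shows "admissible_kernel M \<kappa>"
proof -
  interpret nonneg_kernel M \<kappa>
    using assms(1-3) pos by (intro nonneg_kernel_if_continuous) (auto simp: less_imp_le)
  show ?thesis
    unfolding admissible_kernel_def
    using assms kernel_measurable cont irreducible_if_positive[OF pos] min_degree_pos[OF deg]
    by (auto simp: less_imp_le continuous_on_eq_continuous_at)
qed

section \<open>The Gaussian measure and the constant kernel: equality of both values\<close>

text \<open>The examples use a probability measure on the line that charges every interval, in
  particular both tails.\<close>

definition gauss :: "real measure" where
  "gauss = density lborel std_normal_density"

lemma prob_space_gauss: "prob_space gauss"
  by (simp add: gauss_def prob_space_normal_density)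

lemma sets_gauss [simp, measurable_cong]: "sets gauss = sets borel"
  by (simp add: gauss_def)

lemma space_gauss [simp]: "space gauss = UNIV"
  by (simp add: gauss_def)

text \<open>The density is positive everywhere, so null sets are Lebesgue null and cannot contain an
  interval.\<close>

lemma gauss_not_null:
  assumes "a < b" "{a<..<b} \<subseteq> A" "A \<in> sets borel"
  shows "A \<notin> null_sets gauss"
proof
  assume "A \<in> null_sets gauss"
  then have "AE x in gauss. x \<notin> A"
    by (rule AE_not_in)
  moreover have "(AE x in gauss. x \<notin> A) \<longleftrightarrow> (AE x in lborel. x \<notin> A)"
    unfolding gauss_def by (subst AE_density) (auto simp: normal_density_pos)
  ultimately have "AE x in lborel. x \<notin> A"
    by blast
  then have "A \<in> null_sets lborel"
    using assms(3) by (subst AE_iff_null_sets) auto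
  then have "{a<..<b} \<in> null_sets lborel"
    by (rule null_sets_subset) (use assms(2) in auto)
  then show False
    using assms(1) by (simp add: null_sets_def)
qed

text \<open>The single part carries a loop, which squeezes both values to 1.\<close>

lemma Delta_lower_eq_Delta_upper_example:
  defines "\<kappa> \<equiv> \<lambda>_. 1"
  shows "admissible_kernel gauss \<kappa> \<and> \<Delta>\<^sub>l gauss \<kappa> < \<infinity> \<and> \<Delta>\<^sub>l gauss \<kappa> = \<Delta>\<^sub>u gauss \<kappa>"
proof -
  interpret prob_space gauss
    by (rule prob_space_gauss)
  have adm: "admissible_kernel gauss \<kappa>"
    using prob_space_gauss prob_space
    by (intro admissible_kernelI[where d=1]) (auto simp: \<kappa>_def kernel_degree_def)
  interpret nonneg_kernel gauss \<kappa>
    using adm by (rule admissible_imp_nonneg_kernel)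
  have "kernel_lower gauss \<kappa> UNIV UNIV > 0"
    by (subst kernel_lower_pos_iff) (auto simp: \<kappa>_def intro: exI[of _ 1])
  then have "graph_dist (lower_edges gauss \<kappa> {UNIV}) UNIV UNIV \<le> 1"
    unfolding graph_dist_def one_enat_def by (intro INF_lower) (simp add: lower_edges_def)
  then have "graph_diam {UNIV} (lower_edges gauss \<kappa> {UNIV}) \<le> 1"
    by (simp add: graph_diam_def)
  moreover have "\<Delta>\<^sub>l gauss \<kappa> \<le> graph_diam {UNIV} (lower_edges gauss \<kappa> {UNIV})"
    unfolding Delta_lower_def using positive_partition_space by (intro INF_lower) simp
  ultimately have "\<Delta>\<^sub>l gauss \<kappa> \<le> 1"
    by (rule order_trans[rotated])
  moreover from this have "\<Delta>\<^sub>l gauss \<kappa> < \<infinity>"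
    by (rule order.strict_trans1) (simp add: one_enat_def)
  ultimately show ?thesis
    using adm one_le_Delta_upper Delta_upper_le_Delta_lower by (meson order_antisym order_trans)
qed

section \<open>The gap kernel: a difference of 2\<close>

text \<open>As \<open>x\<close> tends to \<open>\<infinity>\<close>, this kernel tends to \<open>1\<close> for \<open>y > 0\<close> but to \<open>0\<close> for \<open>y \<le> 0\<close>, and
  symmetrically as \<open>x\<close> tends to \<open>-\<infinity>\<close>. Hence no part is lower-adjacent both to a part that is
  unbounded above and to one that is unbounded below, although the kernel is positive.\<close>

definition gap_kernel :: "real \<times> real \<Rightarrow> real" where
  "gap_kernel = (\<lambda>(x, y). max (exp (- \<bar>x\<bar> - \<bar>y\<bar>)) (min 1 (x * y)))"

lemma gap_kernel_bounds: "0 < gap_kernel z" "gap_kernel z \<le> 1"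
  by (auto simp: gap_kernel_def less_max_iff_disj split: prod.split)

lemma gap_kernel_commute: "gap_kernel (x, y) = gap_kernel (y, x)"
proof -
  have "- \<bar>x\<bar> - \<bar>y\<bar> = - \<bar>y\<bar> - \<bar>x\<bar>"
    by simp
  then show ?thesis
    by (simp only: gap_kernel_def prod.case mult.commute[of x y])
qed

text \<open>When the signs are opposite the term \<open>min 1 (x * y)\<close> is at most 0, so only
  the exponential remains, and it decays in each variable.\<close>

lemma gap_kernel_le:
  assumes "x * y \<le> 0"
  shows "gap_kernel (x, y) \<le> exp (- \<bar>x\<bar>)" "gap_kernel (x, y) \<le> exp (- \<bar>y\<bar>)"
proof -
  have "min 1 (x * y) \<le> exp t" for t
    using assms by (meson exp_ge_zero min.coboundedI2 order_trans)
  then show "gap_kernel (x, y) \<le> exp (- \<bar>x\<bar>)" "gap_kernel (x, y) \<le> exp (- \<bar>y\<bar>)"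
    by (auto simp: gap_kernel_def)
qed

text \<open>Cutting at -1 and 1 gives \<open>x * y \<ge> 1\<close> within each tail and
  \<open>\<bar>x\<bar> + \<bar>y\<bar> < 2\<close> within the middle, so every part carries a lower
  loop.\<close>

definition gap_partition :: "real set set" where
  "gap_partition = {{..-1}, {-1<..<1}, {1..}}"

lemma gap_kernel_ge:
  assumes "A \<in> gap_partition" "x \<in> A" "y \<in> A"
  shows "exp (-2) \<le> gap_kernel (x, y)"
proof -
  consider "\<bar>x\<bar> < 1" "\<bar>y\<bar> < 1" | "1 \<le> x" "1 \<le> y" | "1 \<le> - x" "1 \<le> - y"
    using assms by (auto simp: gap_partition_def)
  then show ?thesis
  proof cases
    case 1
    then have "exp (-2) \<le> exp (- \<bar>x\<bar> - \<bar>y\<bar>)"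
      by simp
    then show ?thesis
      by (simp add: gap_kernel_def le_max_iff_disj)
  next
    case 2
    then have "1 \<le> x * y"
      using mult_mono[of 1 x 1 y] by simp
    then show ?thesis
      by (simp add: gap_kernel_def le_max_iff_disj)
  next
    case 3
    then have "1 \<le> x * y"
      using mult_mono[of 1 "- x" 1 "- y"] by simp
    then show ?thesis
      by (simp add: gap_kernel_def le_max_iff_disj)
  qed
qed

lemma positive_gap_partition: "positive_partition gauss gap_partition"
proof -
  interpret prob_space gauss
    by (rule prob_space_gauss)
  have "{..-1::real} \<notin> null_sets gauss"
    by (rule gauss_not_null[of "-2" "-1"]) auto
  moreover have "{-1<..<1::real} \<notin> null_sets gauss"
    by (rule gauss_not_null[of "-1" 1]) auto
  moreover have "{1::real..} \<notin> null_sets gauss"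
    by (rule gauss_not_null[of 1 2]) auto
  ultimately have "A \<in> sets gauss \<and> 0 < prob A" if "A \<in> gap_partition" for A
    using that by (auto simp: gap_partition_def null_sets_def emeasure_eq_measure zero_less_measure_iff)
  moreover have "partition_on UNIV gap_partition"
    by (rule partition_onI) (auto simp: gap_partition_def disjnt_def)
  ultimately show ?thesis
    by (auto simp: positive_partition_def gap_partition_def)
qed

lemma admissible_gap_kernel: "admissible_kernel gauss gap_kernel"
proof -
  interpret prob_space gauss
    by (rule prob_space_gauss)
  have cont: "continuous_on UNIV gap_kernel"
    unfolding gap_kernel_def case_prod_unfold by (intro continuous_intros)
  \<comment> \<open>Each point gains degree at least \<open>exp (-2) * prob A\<close> from its own
    part \<open>A\<close>; the minimum over the three parts is uniform.\<close>
  define d where "d = exp (-2) * Min (prob ` gap_partition)"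
  have fin: "finite (prob ` gap_partition)" "prob ` gap_partition \<noteq> {}"
    by (auto simp: gap_partition_def)
  interpret nonneg_kernel gauss gap_kernel
    using prob_space_gauss cont gap_kernel_bounds
    by (intro nonneg_kernel_if_continuous) (auto simp: less_imp_le)
  have "d \<le> kernel_degree gauss gap_kernel x" for x
  proof -
    obtain A where A: "A \<in> gap_partition" "x \<in> A"
      using positive_gap_partition by (auto simp: positive_partition_def partition_on_def)
    have "d \<le> exp (-2) * prob A"
      unfolding d_def using A(1) fin by (intro mult_left_mono Min_le) auto
    also have "\<dots> \<le> kernel_degree gauss gap_kernel x"
      using A gap_kernel_ge gap_kernel_bounds partition_sets[OF positive_gap_partition A(1)]
      by (intro degree_ge) auto
    finally show ?thesis .
  qed
  moreover have "0 < d"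
    using positive_gap_partition fin by (simp add: d_def positive_partition_def Min_gr_iff)
  ultimately show ?thesis
    using cont gap_kernel_bounds gap_kernel_commute prob_space_gauss
    by (intro admissible_kernelI[where d=d]) auto
qed

text \<open>Some part \<open>C\<close> reaches arbitrarily far to the left in positive measure, and
  some \<open>D\<close> to the right. Lower neighbours of \<open>C\<close> are almost negative and
  those of \<open>D\<close> almost positive, which excludes walks of length 1 and 2.\<close>

lemma Delta_lower_gap_kernel_ge: "3 \<le> \<Delta>\<^sub>l gauss gap_kernel"
proof -
  interpret nonneg_kernel gauss gap_kernel
    by (rule admissible_imp_nonneg_kernel[OF admissible_gap_kernel])
  have "3 \<le> graph_diam P (lower_edges gauss gap_kernel P)" if P: "positive_partition gauss P" for P
  proof -
    have "{..< - real n} \<notin> null_sets gauss" for n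
      by (rule gauss_not_null[of "- real n - 1" "- real n"]) auto
    then obtain C where C: "C \<in> P" "\<And>n. C \<inter> {..< - real n} \<notin> null_sets gauss"
      using part_meets_decreasing[OF P, of "\<lambda>n. {..< - real n}"] by (auto simp: decseq_def)
    have "{real n<..} \<notin> null_sets gauss" for n
      by (rule gauss_not_null[of "real n" "real n + 1"]) auto
    then obtain D where D: "D \<in> P" "\<And>n. D \<inter> {real n<..} \<notin> null_sets gauss"
      using part_meets_decreasing[OF P, of "\<lambda>n. {real n<..}"] by (auto simp: decseq_def)
    have small: "\<exists>n. exp (- real n) < c" if "0 < c" for c :: real
    proof -
      obtain n where "- ln c < real n"
        using reals_Archimedean2 by blast
      then have "exp (- real n) < exp (ln c)"
        by simp
      then show ?thesis
        using that by auto
    qed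
    have CE: "E \<inter> {0..} \<in> null_sets gauss" if "(C, E) \<in> lower_edges gauss gap_kernel P" for E
    proof -
      have s: "C \<in> sets gauss" "E \<in> sets gauss" and l: "kernel_lower gauss gap_kernel C E > 0"
        using that partition_sets[OF P] by (auto simp: lower_edges_def)
      obtain c where c: "c > 0" "\<And>X Y. X \<in> sets gauss \<Longrightarrow> Y \<in> sets gauss \<Longrightarrow> X \<subseteq> C \<Longrightarrow> Y \<subseteq> E \<Longrightarrow>
          (\<And>z. z \<in> X \<times> Y \<Longrightarrow> gap_kernel z < c) \<Longrightarrow> X \<in> null_sets gauss \<or> Y \<in> null_sets gauss"
        using kernel_lower_pos_null_rectangle[OF l s] by blast
      obtain n where n: "exp (- real n) < c"
        using small[OF c(1)] by blast
      \<comment> \<open>On this rectangle the signs are opposite and the first coordinate is beyond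
        \<open>n\<close>, so the kernel is below \<open>c\<close>; since the tail of
        \<open>C\<close> is not null, the other side must be.\<close>
      have "gap_kernel z < c" if z: "z \<in> (C \<inter> {..< - real n}) \<times> (E \<inter> {0..})" for z
      proof -
        obtain x y where xy: "z = (x, y)" "x < - real n" "0 \<le> y"
          using z by auto
        then have "x * y \<le> 0"
          by (intro mult_nonpos_nonneg) auto
        then have "gap_kernel z \<le> exp (- \<bar>x\<bar>)"
          unfolding xy(1) by (rule gap_kernel_le)
        also have "\<dots> \<le> exp (- real n)"
          using xy by simp
        finally show ?thesis
          using n by simp
      qed
      then show ?thesis
        using c(2)[of "C \<inter> {..< - real n}" "E \<inter> {0..}"] C(2) s by auto
    qed
    have ED: "E \<inter> {..0} \<in> null_sets gauss" if "(E, D) \<in> lower_edges gauss gap_kernel P" for E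
    proof -
      have s: "E \<in> sets gauss" "D \<in> sets gauss" and l: "kernel_lower gauss gap_kernel E D > 0"
        using that partition_sets[OF P] by (auto simp: lower_edges_def)
      obtain c where c: "c > 0" "\<And>X Y. X \<in> sets gauss \<Longrightarrow> Y \<in> sets gauss \<Longrightarrow> X \<subseteq> E \<Longrightarrow> Y \<subseteq> D \<Longrightarrow>
          (\<And>z. z \<in> X \<times> Y \<Longrightarrow> gap_kernel z < c) \<Longrightarrow> X \<in> null_sets gauss \<or> Y \<in> null_sets gauss"
        using kernel_lower_pos_null_rectangle[OF l s] by blast
      obtain n where n: "exp (- real n) < c"
        using small[OF c(1)] by blast
      have "gap_kernel z < c" if z: "z \<in> (E \<inter> {..0}) \<times> (D \<inter> {real n<..})" for z
      proof -
        obtain x y where xy: "z = (x, y)" "real n < y" "x \<le> 0"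
          using z by auto
        then have "x * y \<le> 0"
          by (intro mult_nonpos_nonneg) auto
        then have "gap_kernel z \<le> exp (- \<bar>y\<bar>)"
          unfolding xy(1) by (rule gap_kernel_le)
        also have "\<dots> \<le> exp (- real n)"
          using xy by simp
        finally show ?thesis
          using n by simp
      qed
      then show ?thesis
        using c(2)[of "E \<inter> {..0}" "D \<inter> {real n<..}"] D(2) s by auto
    qed
    have 1: "(C, D) \<notin> lower_edges gauss gap_kernel P"
    proof
      assume "(C, D) \<in> lower_edges gauss gap_kernel P"
      from CE[OF this] have "D \<inter> {0<..} \<in> null_sets gauss"
        by (rule null_sets_subset) (use partition_sets[OF P D(1)] in auto)
      then show False
        using D(2)[of 0] by simp
    qed
    have 2: "(E, D) \<notin> lower_edges gauss gap_kernel P" if "(C, E) \<in> lower_edges gauss gap_kernel P" for E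
    proof
      assume ED': "(E, D) \<in> lower_edges gauss gap_kernel P"
      then have "E \<in> P"
        by (simp add: lower_edges_def)
      have "(E \<inter> {0..}) \<union> (E \<inter> {..0}) \<in> null_sets gauss"
        using CE[OF that] ED[OF ED'] by blast
      moreover have "(E \<inter> {0..}) \<union> (E \<inter> {..0}) = E"
        by auto
      ultimately show False
        using partition_not_null[OF P \<open>E \<in> P\<close>] by simp
    qed
    have "3 \<le> graph_dist (lower_edges gauss gap_kernel P) C D"
      unfolding graph_dist_def
    \<comment> \<open>The parts \<open>C\<close> and \<open>D\<close> may coincide; length 0 is
      excluded by the convention on self-distances.\<close>
    proof (rule INF_greatest, clarify)
      fix n assume n: "1 \<le> n" "(C, D) \<in> lower_edges gauss gap_kernel P ^^ n"
      have "n \<noteq> 1" "n \<noteq> 2"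
        using n 1 2 by (auto simp: numeral_2_eq_2)
      then show "3 \<le> enat n"
        using n(1) by (simp add: numeral_eq_enat)
    qed
    also have "\<dots> \<le> graph_diam P (lower_edges gauss gap_kernel P)"
      unfolding graph_diam_def using C(1) D(1) by (meson SUP_upper SUP_upper2)
    finally show ?thesis .
  qed
  then show ?thesis
    unfolding Delta_lower_def by (intro INF_greatest) simp
qed

lemma Delta_lower_eq_Delta_upper_plus_2_example:
  "admissible_kernel gauss gap_kernel \<and> \<Delta>\<^sub>l gauss gap_kernel < \<infinity> \<and>
    \<Delta>\<^sub>l gauss gap_kernel = \<Delta>\<^sub>u gauss gap_kernel + 2"
proof -
  interpret nonneg_kernel gauss gap_kernel
    by (rule admissible_imp_nonneg_kernel[OF admissible_gap_kernel])
  obtain R where "rectangle_kernel gauss gap_kernel R"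
    using countable_rectangle_cover admissible_gap_kernel by (auto simp: admissible_kernel_def)
  then interpret rectangle_kernel gauss gap_kernel R .
  have "(A, A) \<in> lower_edges gauss gap_kernel gap_partition" if A: "A \<in> gap_partition" for A
  proof -
    have "AE z in gauss \<Otimes>\<^sub>M gauss. z \<in> A \<times> A \<longrightarrow> exp (-2) \<le> gap_kernel z"
      using gap_kernel_ge[OF A] by (intro AE_I2) auto
    then have "kernel_lower gauss gap_kernel A A > 0"
      using kernel_lower_pos_iff partition_sets[OF positive_gap_partition A] exp_gt_zero by blast
    then show ?thesis
      using A by (simp add: lower_edges_def)
  qed
  \<comment> \<open>The loops rule out isolated parts, so the general bound gives at most 3 and also
    finiteness, without computing the diameter of an explicit partition.\<close>
  then have le: "\<Delta>\<^sub>l gauss gap_kernel \<le> \<Delta>\<^sub>u gauss gap_kernel + 2"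
    using Delta_lower_le_of_no_isolated_part[OF positive_gap_partition] by blast
  have "\<Delta>\<^sub>u gauss gap_kernel = 1"
    using one_le_Delta_upper Delta_upper_le_one gap_kernel_bounds by (intro antisym) auto
  then have "\<Delta>\<^sub>u gauss gap_kernel + 2 = 3"
    by (simp add: one_enat_def numeral_eq_enat)
  then have "\<Delta>\<^sub>l gauss gap_kernel = 3" "\<Delta>\<^sub>l gauss gap_kernel = \<Delta>\<^sub>u gauss gap_kernel + 2"
    using le Delta_lower_gap_kernel_ge by (metis antisym)+
  then show ?thesis
    using admissible_gap_kernel by (metis enat_ord_simps(4) numeral_eq_enat enat.distinct(1))
qed

theorem theorem1:
  fixes M :: "'a::{metric_space, second_countable_topology} measure"
    and \<kappa> :: "'a \<times> 'a \<Rightarrow> real"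
  shows "(admissible_kernel M \<kappa> \<and> \<Delta>\<^sub>l M \<kappa> < \<infinity> \<longrightarrow>
      \<Delta>\<^sub>u M \<kappa> \<le> \<Delta>\<^sub>l M \<kappa> \<and> \<Delta>\<^sub>l M \<kappa> \<le> \<Delta>\<^sub>u M \<kappa> + 2) \<and>
    (\<exists>(N :: real measure) \<eta>.
      admissible_kernel N \<eta> \<and> \<Delta>\<^sub>l N \<eta> < \<infinity> \<and> \<Delta>\<^sub>l N \<eta> = \<Delta>\<^sub>u N \<eta>) \<and>
    (\<exists>(N :: real measure) \<eta>.
      admissible_kernel N \<eta> \<and> \<Delta>\<^sub>l N \<eta> < \<infinity> \<and> \<Delta>\<^sub>l N \<eta> = \<Delta>\<^sub>u N \<eta> + 2)"
  using nonneg_kernel.Delta_upper_le_Delta_lower[OF admissible_imp_nonneg_kernel]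
    Delta_lower_le_Delta_upper_plus_2 Delta_lower_eq_Delta_upper_example
    Delta_lower_eq_Delta_upper_plus_2_example
  by blast

end
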